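(* Let $H:\mathbb{R}^d\to\mathbb{R}$, $p\mapsto H(p)$, be a continuous Hamiltonian (depending only on $p$), and let $u_0:\mathbb{R}^d\to\mathbb{R}$ be Lipschitz and concave. Let $u_0^*(p):=\inf_{x\in\mathbb{R}^d}(p\cdot x-u_0(x))\in[-\infty,\infty[$ and $P:=\{p\in\mathbb{R}^d:u_0^*(p)>-\infty\}$. Then the function $$u(t,x):=\min_{p\in P}\big(p\cdot x-u_0^*(p)-tH(p)\big)$$ is a viscosity solution of $\partial_tu+H(\partial_xu)=0$ on $[0,\infty[\times\mathbb{R}^d$. If, in addition, $H$ is $C^2$ and there is a constant $A$ such that $|d^2H(p)|\leq A$, $|dH(p)|\leq A(1+|p|)$ and $|H(p)|\leq A(1+|p|)^2$ for all $p$, then $$v(t,x)=g(t,x)=\min_{p\in P}\big(p\cdot x-u_0^*(p)-tH(p)\big)$$ for all $(t,x)\in[0,\infty[\times\mathbb{R}^d$, where $v(t,x)=V_0^tu_0(x)$ is the viscosity solution and $g(t,x)=G_0^tu_0(x)$ is the variational solution (for a fixed variational resolution $G$) with initial condition $u_0$ at time $0$.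
   Context: The Hamilton-Jacobi equation is $\partial_tu+H(\partial_xu)=0$ (HJ). A continuous function $w$ on an open subset of $\mathbb{R}\times\mathbb{R}^d$ is a viscosity solution of (HJ) if each smooth $\phi$ having a contact from above (resp. from below) with $w$ at a point $(t_0,x_0)$ satisfies $\partial_t\phi(t_0,x_0)+H(\partial_x\phi(t_0,x_0))\leq0$ (resp. $\geq0$). "Viscosity solution on $[0,\infty[\times\mathbb{R}^d$" means: viscosity solution on $]0,\infty[\times\mathbb{R}^d$, for the Cauchy problem with initial condition $u(0,\cdot)=u_0$. The following is used under the additional assumptions on $H$. The Hamiltonian system is $\dot q=\partial_pH(p)$, $\dot p=0$. For a locally Lipschitz $u:\mathbb{R}^d\to\mathbb{R}$, the Clarke differential $Du(x)$ is the convex hull of the set of limits $\lim du(x_n)$ with $x_n\to x$ points of differentiability of $u$. For Lipschitz $u$, $(t,x)\mapsto V_s^tu(x)$ is the unique function $v$ on $[s,\infty[\times\mathbb{R}^d$ that is a viscosity solution on $]s,\infty[\times\mathbb{R}^d$, with $v(s,\cdot)=u$ and $v(t,x)-u(x)$ bounded and Lipschitz on $]s,T[\times\mathbb{R}^d$ for each $T>s$. A function $g:[s,\infty)\times\mathbb{R}^d\to\mathbb{R}$ is a variational solution with Lipschitz initial data $u$ at time $s$ if it is locally Lipschitz, $g(s,\cdot)=u$, it solves (HJ) almost everywhere, and for each $(t,x)$ with $t>s$ there is a trajectory $(q,p)$ of the Hamiltonian system with $q(t)=x$, $p(s)\in Du(q(s))$ and $g(t,x)=u(q(s))+\int_s^tp(\tau)\cdot\dot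 q(\tau)-H(p(\tau))\,d\tau$. A variational resolution is a family of operators $G_s^t$, $s\leq t$, from the space of Lipschitz functions on $\mathbb{R}^d$ to itself such that $(t,x)\mapsto G_s^tu(x)$ is a variational solution with initial data $u$ at time $s$ and: (1) $Lip(G_s^tu)\leq(Lip(u)+1)e^{A(t-s)}-1$ and $\|G_s^tu-u\|_\infty\leq A(t-s)\big((Lip(u)+1)e^{A(t-s)}\big)^2$; (2) $u\leq w\Rightarrow G_s^tu\leq G_s^tw$; (3) if $f:\,]T^-,T^+[\times\mathbb{R}^d\to\mathbb{R}$ is a $C^2$ solution of (HJ) then $G_s^tf_s=f_t$ for $s\leq t$ in $]T^-,T^+[$, where $f_t=f(t,\cdot)$. Variational resolutions exist (not unique); one, $G$, is fixed. *)

theory Defs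
  imports "HOL-Analysis.Analysis"
begin

section \<open>Differential calculus\<close>

definition grad :: "('a::real_inner \<Rightarrow> real) \<Rightarrow> 'a \<Rightarrow> 'a" where
  "grad f x = (THE D. GDERIV f x :> D)"

text \<open>\<open>Ck_on k S f\<close>: \<open>f\<close> is \<open>k\<close> times continuously differentiable on the (open) set \<open>S\<close>.
  The recursion runs through the directional derivatives, so that the codomain does not change.\<close>

primrec Ck_on :: "nat \<Rightarrow> 'a::euclidean_space set \<Rightarrow> ('a \<Rightarrow> real) \<Rightarrow> bool" where
  "Ck_on 0 S f \<longleftrightarrow> continuous_on S f"
| "Ck_on (Suc k) S f \<longleftrightarrow>
     (\<forall>x\<in>S. f differentiable (at x)) \<and>
     (\<forall>h. Ck_on k S (\<lambda>x. frechet_derivative f (at x) h))"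

definition smooth_on :: "'a::euclidean_space set \<Rightarrow> ('a \<Rightarrow> real) \<Rightarrow> bool" where
  "smooth_on S f \<longleftrightarrow> (\<forall>k. Ck_on k S f)"

section \<open>Lipschitz functions\<close>

definition lipschitz_fun :: "('a::metric_space \<Rightarrow> real) \<Rightarrow> bool" where
  "lipschitz_fun u \<longleftrightarrow> (\<exists>L. L-lipschitz_on UNIV u)"

definition Lip :: "('a::metric_space \<Rightarrow> real) \<Rightarrow> real" where
  "Lip u = Inf {L. L-lipschitz_on UNIV u}"

definition locally_lipschitz_on :: "'a::metric_space set \<Rightarrow> ('a \<Rightarrow> real) \<Rightarrow> bool" where
  "locally_lipschitz_on S f \<longleftrightarrow> (\<forall>z\<in>S. \<exists>r>0. \<exists>L. L-lipschitz_on (ball z r \<inter> S) f)"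

section \<open>Classical and viscosity solutions of the Hamilton--Jacobi equation\<close>

text \<open>For a function \<open>f\<close> on \<open>real \<times> 'a\<close>, the components of \<open>grad f (t, x)\<close> are
  the time derivative and the space gradient.\<close>

definition HJ_op :: "('a::euclidean_space \<Rightarrow> real) \<Rightarrow> (real \<times> 'a \<Rightarrow> real) \<Rightarrow> real \<times> 'a \<Rightarrow> real" where
  "HJ_op H f z = fst (grad f z) + H (snd (grad f z))"

definition contact_above ::
  "('a::euclidean_space) set \<Rightarrow> ('a \<Rightarrow> real) \<Rightarrow> ('a \<Rightarrow> real) \<Rightarrow> 'a \<Rightarrow> bool" where
  "contact_above U \<phi> w z \<longleftrightarrow> \<phi> z = w z \<and> (\<forall>y\<in>U. w y \<le> \<phi> y)"

definition contact_below ::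
  "('a::euclidean_space) set \<Rightarrow> ('a \<Rightarrow> real) \<Rightarrow> ('a \<Rightarrow> real) \<Rightarrow> 'a \<Rightarrow> bool" where
  "contact_below U \<phi> w z \<longleftrightarrow> \<phi> z = w z \<and> (\<forall>y\<in>U. \<phi> y \<le> w y)"

text \<open>Contacts are local: test functions live on an arbitrary open neighbourhood \<open>U\<close>
  of the contact point.\<close>

definition viscosity_solution ::
  "('a::euclidean_space \<Rightarrow> real) \<Rightarrow> (real \<times> 'a) set \<Rightarrow> (real \<times> 'a \<Rightarrow> real) \<Rightarrow> bool" where
  "viscosity_solution H \<Omega> w \<longleftrightarrow>
     continuous_on \<Omega> w \<and>
     (\<forall>z\<in>\<Omega>. \<forall>U \<phi>. open U \<and> z \<in> U \<and> U \<subseteq> \<Omega> \<and> smooth_on U \<phi> \<longrightarrow>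
        (contact_above U \<phi> w z \<longrightarrow> HJ_op H \<phi> z \<le> 0) \<and>
        (contact_below U \<phi> w z \<longrightarrow> HJ_op H \<phi> z \<ge> 0))"

text \<open>The Cauchy problem. Continuity up to the initial time is required; otherwise the
  initial condition would not constrain \<open>w\<close> at later times.\<close>

definition viscosity_solution_Cauchy ::
  "('a::euclidean_space \<Rightarrow> real) \<Rightarrow> real \<Rightarrow> ('a \<Rightarrow> real) \<Rightarrow> (real \<times> 'a \<Rightarrow> real) \<Rightarrow> bool" where
  "viscosity_solution_Cauchy H s u w \<longleftrightarrow>
     continuous_on ({s..} \<times> UNIV) w \<and>
     viscosity_solution H ({s<..} \<times> UNIV) w \<and>
     (\<forall>x. w (s, x) = u x)"

definition viscosity_evolution ::
  "('a::euclidean_space \<Rightarrow> real) \<Rightarrow> real \<Rightarrow> ('a \<Rightarrow> real) \<Rightarrow> (real \<times> 'a \<Rightarrow> real) \<Rightarrow> bool" where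
  "viscosity_evolution H s u v \<longleftrightarrow>
     viscosity_solution_Cauchy H s u v \<and>
     (\<forall>T>s. bounded ((\<lambda>(t, x). v (t, x) - u x) ` ({s<..<T} \<times> UNIV)) \<and>
            (\<exists>L. L-lipschitz_on ({s<..<T} \<times> UNIV) (\<lambda>(t, x). v (t, x) - u x)))"

text \<open>The viscosity operator \<open>V\<close>. Extensionality makes the function on
  \<open>{s..} \<times> UNIV\<close> a unique HOL function.\<close>

definition visc_op ::
  "('a::euclidean_space \<Rightarrow> real) \<Rightarrow> real \<Rightarrow> real \<Rightarrow> ('a \<Rightarrow> real) \<Rightarrow> 'a \<Rightarrow> real" where
  "visc_op H s t u x =
     (THE v. v \<in> extensional ({s..} \<times> UNIV) \<and> viscosity_evolution H s u v) (t, x)"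

section \<open>Variational solutions and resolutions\<close>

definition hamiltonian_trajectory ::
  "('a::euclidean_space \<Rightarrow> real) \<Rightarrow> real \<Rightarrow> real \<Rightarrow> (real \<Rightarrow> 'a) \<Rightarrow> (real \<Rightarrow> 'a) \<Rightarrow> bool" where
  "hamiltonian_trajectory H s t q p \<longleftrightarrow>
     (\<forall>\<tau>\<in>{s..t}.
        (q has_vector_derivative grad H (p \<tau>)) (at \<tau> within {s..t}) \<and>
        (p has_vector_derivative 0) (at \<tau> within {s..t}))"

definition clarke_diff :: "('a::euclidean_space \<Rightarrow> real) \<Rightarrow> 'a \<Rightarrow> 'a set" where
  "clarke_diff u x = convex hull
     {l. \<exists>X :: nat \<Rightarrow> 'a. (\<forall>n. u differentiable (at (X n))) \<and>
           X \<longlonglongrightarrow> x \<and> (\<lambda>n. grad u (X n)) \<longlonglongrightarrow> l}"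

definition variational_solution ::
  "('a::euclidean_space \<Rightarrow> real) \<Rightarrow> real \<Rightarrow> ('a \<Rightarrow> real) \<Rightarrow> (real \<times> 'a \<Rightarrow> real) \<Rightarrow> bool" where
  "variational_solution H s u g \<longleftrightarrow>
     locally_lipschitz_on ({s..} \<times> UNIV) g \<and>
     (\<forall>x. g (s, x) = u x) \<and>
     (AE z in lebesgue. z \<in> {s<..} \<times> UNIV \<longrightarrow> g differentiable (at z) \<and> HJ_op H g z = 0) \<and>
     (\<forall>t>s. \<forall>x. \<exists>q p.
        hamiltonian_trajectory H s t q p \<and> q t = x \<and> p s \<in> clarke_diff u (q s) \<and>
        g (t, x) = u (q s) +
          integral {s..t} (\<lambda>\<tau>. p \<tau> \<bullet> vector_derivative q (at \<tau> within {s..t}) - H (p \<tau>)))"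

text \<open>\<open>G s t\<close> is only meaningful on Lipschitz functions; in the last clause this is why \<open>f\<close> at
  time \<open>s\<close> is required to be Lipschitz.\<close>

definition variational_resolution ::
  "('a::euclidean_space \<Rightarrow> real) \<Rightarrow> real \<Rightarrow>
   (real \<Rightarrow> real \<Rightarrow> ('a \<Rightarrow> real) \<Rightarrow> 'a \<Rightarrow> real) \<Rightarrow> bool" where
  "variational_resolution H A G \<longleftrightarrow>
     (\<forall>s t u. s \<le> t \<and> lipschitz_fun u \<longrightarrow> lipschitz_fun (G s t u)) \<and>
     (\<forall>s u. lipschitz_fun u \<longrightarrow> variational_solution H s u (\<lambda>(t, x). G s t u x)) \<and>
     (\<forall>s t u. s \<le> t \<and> lipschitz_fun u \<longrightarrow>
        Lip (G s t u) \<le> (Lip u + 1) * exp (A * (t - s)) - 1 \<and>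
        (\<forall>x. \<bar>G s t u x - u x\<bar> \<le> A * (t - s) * ((Lip u + 1) * exp (A * (t - s)))\<^sup>2)) \<and>
     (\<forall>s t u w. s \<le> t \<and> lipschitz_fun u \<and> lipschitz_fun w \<and> (\<forall>x. u x \<le> w x) \<longrightarrow>
        (\<forall>x. G s t u x \<le> G s t w x)) \<and>
     (\<forall>a b f. Ck_on 2 ({a<..<b} \<times> UNIV) f \<and> (\<forall>z\<in>{a<..<b} \<times> UNIV. HJ_op H f z = 0) \<longrightarrow>
        (\<forall>s t. a < s \<and> s \<le> t \<and> t < b \<and> lipschitz_fun (\<lambda>x. f (s, x)) \<longrightarrow>
           G s t (\<lambda>x. f (s, x)) = (\<lambda>x. f (t, x))))"

definition hamiltonian_bounds :: "('a::euclidean_space \<Rightarrow> real) \<Rightarrow> real \<Rightarrow> bool" where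
  "hamiltonian_bounds H A \<longleftrightarrow>
     (\<forall>p. onorm (frechet_derivative (grad H) (at p)) \<le> A \<and>
          norm (grad H p) \<le> A * (1 + norm p) \<and>
          \<bar>H p\<bar> \<le> A * (1 + norm p)\<^sup>2)"

section \<open>The concave conjugate and the minimum formula\<close>

definition concave_conj :: "('a::euclidean_space \<Rightarrow> real) \<Rightarrow> 'a \<Rightarrow> ereal" where
  "concave_conj u p = (INF x. ereal (p \<bullet> x - u x))"

definition conj_dom :: "('a::euclidean_space \<Rightarrow> real) \<Rightarrow> 'a set" where
  "conj_dom u = {p. concave_conj u p > -\<infinity>}"

definition hopf_term ::
  "('a::euclidean_space \<Rightarrow> real) \<Rightarrow> ('a \<Rightarrow> real) \<Rightarrow> real \<Rightarrow> 'a \<Rightarrow> 'a \<Rightarrow> real" where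
  "hopf_term H u t x p = p \<bullet> x - real_of_ereal (concave_conj u p) - t * H p"

text \<open>That the infimum is a minimum is not part of this definition; attainment has to be
  asserted separately.\<close>

definition hopf ::
  "('a::euclidean_space \<Rightarrow> real) \<Rightarrow> ('a \<Rightarrow> real) \<Rightarrow> real \<Rightarrow> 'a \<Rightarrow> real" where
  "hopf H u t x = (INF p\<in>conj_dom u. hopf_term H u t x p)"

end

theory Submission
  imports Defs
begin

text \<open>The formula is a minimum of affine solutions, hence concave in \<open>(t, x)\<close>. A test function touching it
  from above therefore yields a global supergradient \<open>(a, p)\<close>; at time \<open>0\<close> this says that \<open>p\<close> itself competes
  in the minimum, which is \<open>a + H p \<le> 0\<close>. A test function touching from below also touches a minimising
  affine solution. The viscosity solution is unique by doubling of variables. A variational resolution lies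
  below each affine solution by monotonicity, and above the minimum because along a trajectory \<open>p\<close> is
  constant and, for concave data, the Clarke differential consists of supergradients.\<close>

section \<open>Gradients and supergradients\<close>

text \<open>The data enter through two bounds. The Lipschitz constant of \<open>u\<close> bounds
  every \<open>p\<close> in the domain of the conjugate, so a merely continuous \<open>H\<close> is
  only seen on a ball, where it is bounded. The evolution class is Lipschitz up to the initial time,
  so the momenta in the doubling argument are bounded as well; uniform continuity of
  \<open>H\<close> on a ball then suffices, and the penalty parameters can be fixed once instead of
  being sent to a limit. Uniqueness cannot be bypassed, because \<open>visc_op\<close> is a definite
  description: solving the Cauchy problem does not by itself identify its value. For the variational
  solution, a trajectory ending at \<open>x\<close> satisfies
  \<open>x - q 0 = t *\<^sub>R grad H (p 0)\<close>, so its action collapses to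
  \<open>u (q 0) + p 0 \<bullet> (x - q 0) - t * H (p 0)\<close>. This dominates the term of
  \<open>p 0\<close> in the formula exactly because \<open>p 0\<close> is a supergradient.\<close>

lemma grad_eqI:
  assumes "(f has_derivative (\<lambda>h. h \<bullet> D)) (at x)"
  shows "grad f x = D"
  unfolding grad_def
proof (rule the_equality)
  show "GDERIV f x :> D"
    using assms by (simp add: gderiv_def)
  fix E assume "GDERIV f x :> E"
  then have "(\<lambda>h. h \<bullet> E) = (\<lambda>h. h \<bullet> D)"
    using assms has_derivative_unique unfolding gderiv_def by blast
  then show "E = D"
    by (metis inner_commute vector_eq_ldot)
qed

lemma has_derivative_grad:
  fixes f :: "'a::euclidean_space \<Rightarrow> real"
  assumes "f differentiable (at x)"
  shows "(f has_derivative (\<lambda>h. h \<bullet> grad f x)) (at x)"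
proof -
  obtain f' where f': "(f has_derivative f') (at x)"
    using assms by (auto simp: differentiable_def)
  have "f' h = h \<bullet> adjoint f' 1" for h
    using adjoint_works[OF has_derivative_linear[OF f'], of h 1] by simp
  then have "f' = (\<lambda>h. h \<bullet> adjoint f' 1)"
    by blast
  then show ?thesis
    using f' grad_eqI by metis
qed

text \<open>The inequality is global. Supergradients of the formula at positive times are later
  tested at time 0, far from the base point.\<close>

definition superdiff :: "('a::real_inner \<Rightarrow> real) \<Rightarrow> 'a \<Rightarrow> 'a set" where
  "superdiff u x = {p. \<forall>y. u y \<le> u x + p \<bullet> (y - x)}"

lemma convex_superdiff: "convex (superdiff u x)"
  unfolding convex_alt superdiff_def
proof clarify
  fix p q s y
  assume *: "\<forall>y. u y \<le> u x + p \<bullet> (y - x)" "\<forall>y. u y \<le> u x + q \<bullet> (y - x)"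
    and s: "0 \<le> (s::real)" "s \<le> 1"
  have "(1 - s) * u y + s * u y \<le> (1 - s) * (u x + p \<bullet> (y - x)) + s * (u x + q \<bullet> (y - x))"
    using * s by (intro add_mono mult_left_mono) auto
  then show "u y \<le> u x + ((1 - s) *\<^sub>R p + s *\<^sub>R q) \<bullet> (y - x)"
    by (simp add: inner_add_left algebra_simps)
qed

text \<open>Hahn-Banach: separate \<open>(x, u x)\<close> from the strict hypograph. Strictness
  keeps the point outside the convex set and costs an epsilon at the end.\<close>

lemma superdiff_nonempty:
  fixes u :: "'a::euclidean_space \<Rightarrow> real"
  assumes "concave_on UNIV u"
  shows "superdiff u x \<noteq> {}"
proof -
  define S where "S = {z :: 'a \<times> real. snd z < u (fst z)}"
  have "convex S"
    unfolding convex_alt S_def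
  proof clarify
    fix y r y' r' and s :: real
    assume *: "snd (y, r) < u (fst (y, r))" "snd (y', r') < u (fst (y', r'))" and s: "0 \<le> s" "s \<le> 1"
    have "(1 - s) * r + s * r' < (1 - s) * u y + s * u y'"
    proof (cases "s = 0")
      case False
      then show ?thesis
        using * s by (intro add_le_less_mono mult_left_mono mult_strict_left_mono) auto
    qed (use * in auto)
    also have "\<dots> \<le> u ((1 - s) *\<^sub>R y + s *\<^sub>R y')"
      using concave_onD[OF assms] s by auto
    finally show "snd ((1 - s) *\<^sub>R (y, r) + s *\<^sub>R (y', r')) < u (fst ((1 - s) *\<^sub>R (y, r) + s *\<^sub>R (y', r')))"
      by simp
  qed
  moreover have "(x, u x - 1) \<in> S" "S \<inter> {(x, u x)} = {}"
    by (auto simp: S_def)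
  ultimately obtain c b where c: "c \<noteq> 0" "\<And>z. z \<in> S \<Longrightarrow> c \<bullet> z \<le> b" "b \<le> c \<bullet> (x, u x)"
    using separating_hyperplane_sets[of S "{(x, u x)}"] by (metis convex_singleton empty_iff insertI1)
  obtain a \<alpha> where a: "c = (a, \<alpha>)"
    by fastforce
  have sep: "a \<bullet> y + \<alpha> * r \<le> a \<bullet> x + \<alpha> * u x" if "r < u y" for y r
    using c(2)[of "(y, r)"] c(3) that by (simp add: a S_def)
  have "\<alpha> \<ge> 0"
    using sep[of "u x - 1" x] by (simp add: algebra_simps)
  \<comment> \<open>A vertical hyperplane is impossible since \<open>u\<close> is finite everywhere:
    the hypograph has points above \<open>x + a\<close>, which forces \<open>a = 0\<close>.\<close>
  moreover have "\<alpha> \<noteq> 0"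
  proof
    assume "\<alpha> = 0"
    then have "a \<bullet> (x + a) \<le> a \<bullet> x"
      using sep[of "u (x + a) - 1" "x + a"] by simp
    then have "a \<bullet> a \<le> 0"
      by (simp add: inner_add_right)
    then show False
      using c(1) \<open>\<alpha> = 0\<close> a \<open>a \<bullet> a \<le> 0\<close> by (auto simp: zero_prod_def dest: order_antisym[OF _ inner_ge_zero])
  qed
  ultimately have "\<alpha> > 0" by simp
  have "u y \<le> u x + (- (1 / \<alpha>) *\<^sub>R a) \<bullet> (y - x)" for y
  proof (rule field_le_epsilon)
    fix e :: real assume "e > 0"
    then have "a \<bullet> y + \<alpha> * (u y - e) \<le> a \<bullet> x + \<alpha> * u x"
      by (intro sep) auto
    then have "(a \<bullet> y + \<alpha> * (u y - e)) / \<alpha> \<le> (a \<bullet> x + \<alpha> * u x) / \<alpha>"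
      using \<open>\<alpha> > 0\<close> by (simp add: divide_right_mono)
    then show "u y \<le> u x + (- (1 / \<alpha>) *\<^sub>R a) \<bullet> (y - x) + e"
      using \<open>\<alpha> > 0\<close> by (simp add: add_divide_distrib inner_diff_right diff_divide_distrib algebra_simps)
  qed
  then show ?thesis
    unfolding superdiff_def by blast
qed

text \<open>Concavity makes a local contact global: along the segment from \<open>z\<close> to
  \<open>y\<close> the difference quotients of \<open>w\<close> are at least
  \<open>w y - w z\<close>, and those of \<phi> dominate them near \<open>z\<close>.\<close>

lemma grad_in_superdiff:
  fixes w :: "'a::euclidean_space \<Rightarrow> real"
  assumes conc: "concave_on UNIV w" and "\<phi> differentiable (at z)"
    and "open U" "z \<in> U" "contact_above U \<phi> w z"
  shows "grad \<phi> z \<in> superdiff w z"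
proof -
  have "w y \<le> w z + grad \<phi> z \<bullet> (y - z)" for y
  proof -
    define \<gamma> where "\<gamma> = (\<lambda>s::real. z + s *\<^sub>R (y - z))"
    have "(\<gamma> has_derivative (\<lambda>s. s *\<^sub>R (y - z))) (at 0)"
      unfolding \<gamma>_def by (auto intro!: derivative_eq_intros)
    moreover have "(\<phi> has_derivative (\<lambda>h. h \<bullet> grad \<phi> z)) (at (\<gamma> 0))"
      using has_derivative_grad[OF assms(2)] by (simp add: \<gamma>_def)
    ultimately have "((\<lambda>s. \<phi> (\<gamma> s)) has_derivative (\<lambda>s. (s *\<^sub>R (y - z)) \<bullet> grad \<phi> z)) (at 0)"
      by (rule has_derivative_compose)
    then have "((\<lambda>s. \<phi> (\<gamma> s)) has_real_derivative ((y - z) \<bullet> grad \<phi> z)) (at 0)"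
      by (simp add: has_field_derivative_def mult_commute_abs)
    then have "((\<lambda>s. (\<phi> (\<gamma> s) - \<phi> (\<gamma> 0)) / s) \<longlongrightarrow> (y - z) \<bullet> grad \<phi> z) (at_right 0)"
      unfolding DERIV_def by (auto intro: tendsto_within_subset[of _ _ 0 UNIV])
    moreover have "\<forall>\<^sub>F s in at_right 0. w y - w z \<le> (\<phi> (\<gamma> s) - \<phi> (\<gamma> 0)) / s"
    proof -
      have "isCont \<gamma> 0"
        unfolding \<gamma>_def by (intro continuous_intros)
      then have "(\<gamma> \<longlongrightarrow> z) (at_right 0)"
        unfolding isCont_def by (auto simp: \<gamma>_def intro: tendsto_within_subset[of _ _ 0 UNIV])
      then have "\<forall>\<^sub>F s in at_right 0. \<gamma> s \<in> U"
        using assms(3,4) topological_tendstoD by blast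
      moreover have "\<forall>\<^sub>F s in at_right 0. s \<in> {0<..<1::real}"
        by (rule eventually_at_right_real) simp
      ultimately show ?thesis
      proof eventually_elim
        case (elim s)
        have "(1 - s) * w z + s * w y \<le> w ((1 - s) *\<^sub>R z + s *\<^sub>R y)"
          using concave_onD[OF conc] elim by auto
        also have "(1 - s) *\<^sub>R z + s *\<^sub>R y = \<gamma> s"
          by (simp add: \<gamma>_def algebra_simps)
        also have "w (\<gamma> s) \<le> \<phi> (\<gamma> s)"
          using assms(5) elim by (auto simp: contact_above_def)
        finally have "s * (w y - w z) \<le> \<phi> (\<gamma> s) - \<phi> (\<gamma> 0)"
          using assms(5) by (simp add: contact_above_def \<gamma>_def algebra_simps)
        then show ?case
          using elim by (simp add: field_simps)
      qed
    qed
    ultimately have "w y - w z \<le> (y - z) \<bullet> grad \<phi> z"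
      by (rule tendsto_lowerbound) simp
    then show ?thesis
      by (simp add: inner_commute)
  qed
  then show ?thesis
    by (simp add: superdiff_def)
qed

text \<open>The supergradient inequality survives limits of base point and slope, and convex
  combinations of slopes.\<close>

lemma clarke_diff_subset_superdiff:
  fixes u :: "'a::euclidean_space \<Rightarrow> real"
  assumes conc: "concave_on UNIV u" and cont: "continuous_on UNIV u"
  shows "clarke_diff u x \<subseteq> superdiff u x"
  unfolding clarke_diff_def
proof (rule hull_minimal[of _ _ convex, OF _ convex_superdiff], clarify)
  fix l X
  assume diff: "\<forall>n. u differentiable (at (X n))" and X: "X \<longlonglongrightarrow> x" and l: "(\<lambda>n. grad u (X n)) \<longlonglongrightarrow> l"
  have "u y \<le> u x + l \<bullet> (y - x)" for y
  proof (rule tendsto_lowerbound)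
    have "(\<lambda>n. u (X n)) \<longlonglongrightarrow> u x"
      using cont X by (simp add: continuous_on_eq_continuous_at isCont_tendsto_compose)
    then show "(\<lambda>n. u (X n) + grad u (X n) \<bullet> (y - X n)) \<longlonglongrightarrow> u x + l \<bullet> (y - x)"
      by (intro tendsto_intros l X)
    \<comment> \<open>Where \<open>u\<close> is differentiable, it is its own test function from
      above.\<close>
    have "grad u (X n) \<in> superdiff u (X n)" for n
      using diff by (intro grad_in_superdiff[OF conc, of _ _ UNIV]) (auto simp: contact_above_def)
    then show "\<forall>\<^sub>F n in sequentially. u y \<le> u (X n) + grad u (X n) \<bullet> (y - X n)"
      by (simp add: superdiff_def)
  qed simp
  then show "l \<in> superdiff u x"
    by (simp add: superdiff_def)
qed

section \<open>Uniqueness of the viscosity evolution\<close>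

lemma lipschitz_on_snd:
  fixes u :: "'a::metric_space \<Rightarrow> 'b::metric_space" and S :: "('c::metric_space \<times> 'a) set"
  assumes "L-lipschitz_on UNIV u"
  shows "L-lipschitz_on S (\<lambda>z. u (snd z))"
proof (rule lipschitz_onI)
  show "0 \<le> L"
    using assms lipschitz_on_nonneg by blast
  fix z z' :: "'c \<times> 'a"
  have "dist (u (snd z)) (u (snd z')) \<le> L * dist (snd z) (snd z')"
    using assms lipschitz_onD by blast
  also have "\<dots> \<le> L * dist z z'"
    using \<open>0 \<le> L\<close> dist_snd_le by (rule mult_left_mono[rotated])
  finally show "dist (u (snd z)) (u (snd z')) \<le> L * dist z z'" .
qed

section \<open>Smooth penalties for the doubling of variables\<close>

lemma quadratic_exp_has_derivative:
  fixes z :: "real \<times> 'a::euclidean_space"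
  shows "((\<lambda>z. c + w \<bullet> z + b * (z \<bullet> z) + \<beta> * (snd z \<bullet> snd z) + a * exp (k * fst z)) has_derivative
    (\<lambda>h. h \<bullet> (w + (2 * b) *\<^sub>R z + (a * k * exp (k * fst z), (2 * \<beta>) *\<^sub>R snd z)))) (at z)"
proof -
  have "((\<lambda>z. c + w \<bullet> z + b * (z \<bullet> z) + \<beta> * (snd z \<bullet> snd z) + a * exp (k * fst z)) has_derivative
    (\<lambda>h. 0 + w \<bullet> h + b * (z \<bullet> h + h \<bullet> z) + \<beta> * (snd z \<bullet> snd h + snd h \<bullet> snd z)
      + a * (k * fst h * exp (k * fst z)))) (at z)"
    by (intro has_derivative_add has_derivative_const has_derivative_inner_right has_derivative_ident
        has_derivative_mult_right has_derivative_inner has_derivative_snd has_derivative_fst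
        has_derivative_exp)
  moreover have "(\<lambda>h. 0 + w \<bullet> h + b * (z \<bullet> h + h \<bullet> z) + \<beta> * (snd z \<bullet> snd h + snd h \<bullet> snd z)
      + a * (k * fst h * exp (k * fst z))) =
    (\<lambda>h. h \<bullet> (w + (2 * b) *\<^sub>R z + (a * k * exp (k * fst z), (2 * \<beta>) *\<^sub>R snd z)))"
    by (cases z) (simp add: fun_eq_iff inner_commute algebra_simps)
  ultimately show ?thesis
    by simp
qed

text \<open>This class of functions is closed under directional derivatives.\<close>

lemma smooth_on_quadratic_exp:
  fixes S :: "(real \<times> 'a::euclidean_space) set"
  shows "smooth_on S (\<lambda>z. c + w \<bullet> z + b * (z \<bullet> z) + \<beta> * (snd z \<bullet> snd z) + a * exp (k * fst z))"
  unfolding smooth_on_def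
proof
  fix n
  show "Ck_on n S (\<lambda>z. c + w \<bullet> z + b * (z \<bullet> z) + \<beta> * (snd z \<bullet> snd z) + a * exp (k * fst z))"
  proof (induction n arbitrary: c w b \<beta> a)
    case 0
    show ?case
      by (auto intro!: continuous_intros)
  next
    case (Suc n)
    let ?f = "\<lambda>z. c + w \<bullet> z + b * (z \<bullet> z) + \<beta> * (snd z \<bullet> snd z) + a * exp (k * fst z)"
    \<comment> \<open>The derivative along \<open>h\<close> has new constant, linear and exponential
      coefficients, and both quadratic ones become 0.\<close>
    have "frechet_derivative ?f (at z) h = w \<bullet> h + ((2 * b) *\<^sub>R h + (0, (2 * \<beta>) *\<^sub>R snd h)) \<bullet> z
        + 0 * (z \<bullet> z) + 0 * (snd z \<bullet> snd z) + (a * k * fst h) * exp (k * fst z)" for z h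
      unfolding frechet_derivative_at[OF quadratic_exp_has_derivative, symmetric]
      by (simp add: inner_prod_def inner_add_right inner_add_left inner_commute algebra_simps)
    then have "Ck_on n S (\<lambda>z. frechet_derivative ?f (at z) h)" for h
      by (simp only: Suc.IH)
    moreover have "?f differentiable (at z)" for z
      using quadratic_exp_has_derivative differentiableI by blast
    ultimately show ?case
      by simp
  qed
qed

text \<open>One family serves both sides of the doubling: the test function from below takes
  \<open>b\<close> negative and sets \<beta> and \<open>a\<close> to 0.\<close>

lemma
  fixes y :: "real \<times> 'a::euclidean_space" and x :: 'a and a b c k \<beta> :: real
  defines "pen \<equiv> \<lambda>z. c + b * ((z - y) \<bullet> (z - y)) + \<beta> * ((snd z - x) \<bullet> (snd z - x)) + a * exp (k * fst z)"
  shows smooth_on_penalty: "smooth_on S pen"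
    and grad_penalty: "grad pen z = (2 * b) *\<^sub>R (z - y) + (a * k * exp (k * fst z), (2 * \<beta>) *\<^sub>R (snd z - x))"
proof -
  define c' w where "c' = c + b * (y \<bullet> y) + \<beta> * (x \<bullet> x)"
    and "w = (- 2 * b) *\<^sub>R y + (0, (- 2 * \<beta>) *\<^sub>R x)"
  have pen: "pen = (\<lambda>z. c' + w \<bullet> z + b * (z \<bullet> z) + \<beta> * (snd z \<bullet> snd z) + a * exp (k * fst z))"
    by (auto simp: pen_def c'_def w_def fun_eq_iff inner_prod_def inner_diff_left inner_diff_right
        inner_add_left inner_commute algebra_simps)
  show "smooth_on S pen"
    unfolding pen by (rule smooth_on_quadratic_exp)
  show "grad pen z = (2 * b) *\<^sub>R (z - y) + (a * k * exp (k * fst z), (2 * \<beta>) *\<^sub>R (snd z - x))"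
    using grad_eqI[OF quadratic_exp_has_derivative, of c' w b \<beta> a k z]
    by (simp add: pen w_def prod_eq_iff algebra_simps)
qed

lemma viscosity_solutionD:
  assumes "viscosity_solution H \<Omega> w" "open U" "z \<in> U" "U \<subseteq> \<Omega>" "smooth_on U \<phi>"
  shows "contact_above U \<phi> w z \<Longrightarrow> HJ_op H \<phi> z \<le> 0"
    and "contact_below U \<phi> w z \<Longrightarrow> HJ_op H \<phi> z \<ge> 0"
  using assms unfolding viscosity_solution_def by blast+

text \<open>Doubling of variables. The term \<open>a * exp (k * t)\<close> is negligible at time \<open>t0\<close>, has a derivative
  bounded below by \<open>\<kappa>\<close>, which gives the contradiction, and is so large after time \<open>T1\<close> that it keeps the
  maximum away from the time \<open>T\<close>.\<close>

lemma viscosity_comparison: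
  fixes v w :: "real \<times> 'a::euclidean_space \<Rightarrow> real"
  assumes contH: "continuous_on UNIV H"
    and v: "viscosity_solution H ({s<..} \<times> UNIV) v"
    and w: "viscosity_solution H ({s<..} \<times> UNIV) w"
    and lipv: "K-lipschitz_on ({s..T} \<times> UNIV) v"
    and lipw: "K-lipschitz_on ({s..T} \<times> UNIV) w"
    and init: "\<And>x. v (s, x) \<le> w (s, x)"
    and t0: "s < t0" "t0 < T"
  shows "v (t0, x0) \<le> w (t0, x0)"
proof (rule ccontr)
  assume "\<not> v (t0, x0) \<le> w (t0, x0)"
  define \<delta> where "\<delta> = v (t0, x0) - w (t0, x0)"
  have "\<delta> > 0"
    using \<open>\<not> v (t0, x0) \<le> w (t0, x0)\<close> by (simp add: \<delta>_def)
  define S where "S = {s..T} \<times> (UNIV :: 'a set)"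
  have K: "K \<ge> 0"
    using lipv lipschitz_on_nonneg by blast
  have vD: "v z - v z' \<le> K * dist z z'" and wD: "w z - w z' \<le> K * dist z z'"
    if "z \<in> S" "z' \<in> S" for z z'
    using lipschitz_onD[OF lipv, of z z'] lipschitz_onD[OF lipw, of z z'] that
    by (auto simp: S_def dist_real_def)
  define C where "C = 2 * K * (T - s)"
  have C: "C \<ge> 0"
    using K t0 by (simp add: C_def)
  \<comment> \<open>Go down to time \<open>s\<close> along \<open>v\<close> and back up along
    \<open>w\<close>; each way costs at most \<open>K * (T - s)\<close>.\<close>
  have diff_le: "v z - w z \<le> C" if "z \<in> S" for z
  proof -
    have "(s, snd z) \<in> S" "dist z (s, snd z) \<le> T - s"
      using that t0 by (auto simp: S_def dist_Pair_Pair dist_real_def)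
    moreover from this have "K * dist z (s, snd z) \<le> K * (T - s)"
      using K by (intro mult_left_mono)
    ultimately show ?thesis
      using vD[of z "(s, snd z)"] wD[of "(s, snd z)" z] init[of "snd z"] that
      by (simp add: C_def dist_commute)
  qed

  define T1 where "T1 = (t0 + T) / 2"
  have T1: "t0 < T1" "T1 < T"
    using t0 by (auto simp: T1_def)
  \<comment> \<open>The time penalty is normalised to \<delta>/4 at \<open>t0\<close> and must
    exceed \<open>C + 1\<close> from \<open>T1\<close> on; the bound \<open>exp y > y\<close> at
    \<open>y = k * (t - t0)\<close> dictates \<open>k\<close>.\<close>
  define k where "k = 4 * (C + 1) / (\<delta> * (T1 - t0))"
  define a where "a = \<delta> / 4 * exp (- k * t0)"
  have "k > 0" "a > 0"
    using C \<open>\<delta> > 0\<close> T1 by (auto simp: k_def a_def)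
  have a_exp: "a * exp (k * t) = \<delta> / 4 * exp (k * (t - t0))" for t
    by (simp add: a_def exp_minus exp_diff field_simps)
  have late: "C + 1 < a * exp (k * t)" if "T1 \<le> t" for t
  proof -
    have "4 * (C + 1) / \<delta> = k * (T1 - t0)"
      using T1 by (simp add: k_def)
    also have "\<dots> \<le> k * (t - t0)"
      using that \<open>k > 0\<close> by simp
    also have "\<dots> < exp (k * (t - t0))"
      using exp_ge_add_one_self[of "k * (t - t0)"] by linarith
    finally show ?thesis
      using \<open>\<delta> > 0\<close> by (simp add: a_exp field_simps)
  qed
  define \<kappa> where "\<kappa> = k * (a * exp (k * s))"
  have "\<kappa> > 0"
    using \<open>k > 0\<close> \<open>a > 0\<close> by (simp add: \<kappa>_def)

  \<comment> \<open>One summand per purpose: \<open>1 + K\<^sup>2\<close> for coercivity, the next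
    to keep the maximum off time \<open>s\<close>, the last to keep the second point below time
    \<open>T\<close>.\<close>
  define n where "n = 1 + K\<^sup>2 + 2 * K\<^sup>2 / \<delta> + K / (T - T1)"
  have "2 * K\<^sup>2 / \<delta> \<ge> 0" "K / (T - T1) \<ge> 0"
    using K \<open>\<delta> > 0\<close> T1 by auto
  then have n: "n > 0" "1 + K\<^sup>2 \<le> n" "2 * K\<^sup>2 / \<delta> \<le> n" "K / (T - T1) < n"
    unfolding n_def using zero_le_power2[of K] by linarith+
  then have Kn: "K * (K / n) \<le> \<delta> / 2" "K / n < T - T1"
    using \<open>\<delta> > 0\<close> T1 by (simp_all add: field_simps power2_eq_square)

  \<comment> \<open>The quadratic penalty will produce a momentum of norm at most
    \<open>2 * K\<close>; the localising term shifts it by less than 1.\<close>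
  have "uniformly_continuous_on (cball 0 (2 * K + 1)) H"
    by (intro compact_uniformly_continuous continuous_on_subset[OF contH]) auto
  then obtain e where "e > 0"
    and e: "\<And>p q. \<lbrakk>p \<in> cball 0 (2 * K + 1); q \<in> cball 0 (2 * K + 1); dist q p < e\<rbrakk> \<Longrightarrow> dist (H q) (H p) < \<kappa>"
    using \<open>\<kappa> > 0\<close> unfolding uniformly_continuous_on_def by metis
  define r where "r = min e 1"
  have r: "r > 0" "r \<le> e" "r \<le> 1"
    using \<open>e > 0\<close> by (auto simp: r_def)
  \<comment> \<open>Chosen so that the gradient of the localising term at the maximum has norm at
    most \<open>r / 2\<close>.\<close>
  define \<beta> where "\<beta> = r\<^sup>2 / 16 / (C + 1)"
  have \<beta>: "\<beta> > 0" "16 * \<beta> * (C + 1) = r\<^sup>2"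
    using r(1) C by (simp_all add: \<beta>_def field_simps)

  \<comment> \<open>Localisation and time penalty act on the first variable only, so they cancel
    when just the second variable is moved.\<close>
  define \<Phi> where "\<Phi> = (\<lambda>(z, z'). v z - w z' - n * ((z - z') \<bullet> (z - z'))
      - \<beta> * ((snd z - x0) \<bullet> (snd z - x0)) - a * exp (k * fst z))"
  have z0: "(t0, x0) \<in> S" "\<Phi> ((t0, x0), (t0, x0)) = 3 * \<delta> / 4"
    using t0 a_exp[of t0] by (auto simp: S_def \<Phi>_def \<delta>_def)
  \<comment> \<open>With \<open>D = dist z z'\<close>, the Lipschitz error \<open>K * D\<close> is
    at most \<open>1 + K\<^sup>2 * D\<^sup>2\<close>, which the term with \<open>n\<close> absorbs,
    leaving \<open>D\<^sup>2\<close>.\<close>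
  have coercive: "(dist z z')\<^sup>2 + \<beta> * (dist (snd z) x0)\<^sup>2 + a * exp (k * fst z) \<le> C + 1"
    if "z \<in> S" "z' \<in> S" "\<Phi> (z, z') \<ge> 0" for z z'
  proof -
    have "K * dist z z' \<le> 1 + (K * dist z z')\<^sup>2"
      using zero_le_power2[of "K * dist z z' - 1"] mult_nonneg_nonneg[OF K zero_le_dist[of z z']]
      unfolding power2_diff power_one by linarith
    moreover have "(1 + K\<^sup>2) * (dist z z')\<^sup>2 \<le> n * (dist z z')\<^sup>2"
      using n by (intro mult_right_mono) auto
    moreover have "n * (dist z z')\<^sup>2 + \<beta> * (dist (snd z) x0)\<^sup>2 + a * exp (k * fst z) \<le> v z - w z'"
      using that(3) by (simp add: \<Phi>_def dist_norm power2_norm_eq_inner)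
    ultimately show ?thesis
      using diff_le[OF that(1)] wD[OF that(1,2)] by (simp add: distrib_right power_mult_distrib)
  qed

  define R where "R = sqrt ((C + 1) / \<beta>)"
  define R' where "R' = R + sqrt (C + 1)"
  define Q where "Q = ({s..T} \<times> cball x0 R) \<times> ({s..T} \<times> cball x0 R')"
  have "R \<ge> 0" "R' \<ge> 0"
    using C \<beta>(1) by (auto simp: R_def R'_def)
  have Q: "Q \<subseteq> S \<times> S"
    unfolding Q_def S_def by (intro Sigma_mono) auto
  have in_Q: "(z, z') \<in> Q" if "z \<in> S" "z' \<in> S" "\<Phi> (z, z') \<ge> 0" for z z'
  proof -
    have pos: "a * exp (k * fst z) > 0" "\<beta> * (dist (snd z) x0)\<^sup>2 \<ge> 0" "(dist z z')\<^sup>2 \<ge> 0"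
      using \<open>a > 0\<close> \<beta>(1) by auto
    then have "\<beta> * (dist (snd z) x0)\<^sup>2 \<le> C + 1" "(dist z z')\<^sup>2 \<le> C + 1"
      using coercive[OF that] by linarith+
    then have *: "dist (snd z) x0 \<le> R" "dist z z' \<le> sqrt (C + 1)"
      unfolding R_def using \<beta>(1) by (auto intro!: real_le_rsqrt simp: field_simps)
    have "dist (snd z') x0 \<le> dist z z' + dist (snd z) x0"
      using dist_triangle[of "snd z'" x0 "snd z"] dist_snd_le[of z z'] by (simp add: dist_commute)
    then show ?thesis
      using * that by (auto simp: Q_def S_def R'_def dist_commute)
  qed
  have "continuous_on (S \<times> S) (\<lambda>zz. v (fst zz))" "continuous_on (S \<times> S) (\<lambda>zz. w (snd zz))"
    unfolding S_def
    by (rule continuous_on_compose2[OF lipschitz_on_continuous_on[OF lipv] continuous_on_fst[OF continuous_on_id]]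
        continuous_on_compose2[OF lipschitz_on_continuous_on[OF lipw] continuous_on_snd[OF continuous_on_id]]; auto)+
  then have "continuous_on (S \<times> S) \<Phi>"
    unfolding \<Phi>_def split_beta by (intro continuous_intros)
  moreover have "compact Q"
    unfolding Q_def by (intro compact_Times) auto
  moreover have "((t0, x0), (t0, x0)) \<in> Q"
    using in_Q z0 \<open>\<delta> > 0\<close> by simp
  ultimately obtain z1 z2 where "(z1, z2) \<in> Q" and max_Q: "\<And>zz. zz \<in> Q \<Longrightarrow> \<Phi> zz \<le> \<Phi> (z1, z2)"
    using continuous_attains_sup[of Q \<Phi>] continuous_on_subset[OF _ Q] by fastforce
  have S: "z1 \<in> S" "z2 \<in> S"
    using \<open>(z1, z2) \<in> Q\<close> Q by auto
  have \<Phi>_ge: "3 * \<delta> / 4 \<le> \<Phi> (z1, z2)"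
    using max_Q[OF \<open>((t0, x0), (t0, x0)) \<in> Q\<close>] z0 by simp
  \<comment> \<open>Outside the compact set \<Phi> is negative, so the maximum over it is a maximum
    over the whole slab.\<close>
  have max: "\<Phi> (z, z') \<le> \<Phi> (z1, z2)" if "z \<in> S" "z' \<in> S" for z z'
    using max_Q in_Q[OF that] \<Phi>_ge \<open>\<delta> > 0\<close> by (cases "\<Phi> (z, z') \<ge> 0") auto

  define d where "d = dist z1 z2"
  \<comment> \<open>Compare the maximum with the diagonal pair \<open>(z1, z1)\<close>.\<close>
  have "n * d\<^sup>2 \<le> K * d"
    using max[OF S(1) S(1)] wD[OF S] by (simp add: \<Phi>_def d_def dist_norm power2_norm_eq_inner)
  then have d: "d \<le> K / n"
    using n(1) K by (cases "d = 0") (auto simp: d_def field_simps power2_eq_square)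
  then have Kd: "K * d \<le> \<delta> / 2"
    using mult_left_mono[OF d K] Kn(1) by linarith
  have "n * ((z1 - z2) \<bullet> (z1 - z2)) \<ge> 0" "\<beta> * ((snd z1 - x0) \<bullet> (snd z1 - x0)) \<ge> 0" "a * exp (k * fst z1) > 0"
    using n(1) \<beta>(1) \<open>a > 0\<close> by auto
  then have gap: "3 * \<delta> / 4 < v z1 - w z2"
    using \<Phi>_ge by (simp add: \<Phi>_def)
  \<comment> \<open>At the initial time \<open>v \<le> w\<close>, so the gap would be at most
    \<open>K * d\<close>, hence \<delta>/2, which is below 3\<delta>/4.\<close>
  have "fst z1 \<noteq> s"
  proof
    assume "fst z1 = s"
    then have "v z1 \<le> w z1"
      using init[of "snd z1"] by (metis prod.collapse)
    then show False
      using gap wD[OF S] Kd \<open>\<delta> > 0\<close> by (simp add: d_def)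
  qed
  moreover have "fst z2 \<noteq> s"
  proof
    assume "fst z2 = s"
    then have "v z2 \<le> w z2"
      using init[of "snd z2"] by (metis prod.collapse)
    then show False
      using gap vD[OF S] Kd \<open>\<delta> > 0\<close> by (simp add: d_def)
  qed
  moreover have "fst z1 < T1"
  proof (rule ccontr)
    assume "\<not> fst z1 < T1"
    then have "C + 1 < a * exp (k * fst z1)"
      using late by simp
    moreover have "\<beta> * (dist (snd z1) x0)\<^sup>2 \<ge> 0"
      using \<beta>(1) by simp
    ultimately show False
      using coercive[OF S] \<Phi>_ge \<open>\<delta> > 0\<close> zero_le_power2[of "dist z1 z2"] by linarith
  qed
  moreover have "\<bar>fst z1 - fst z2\<bar> \<le> d"
    using dist_fst_le[of z1 z2] by (simp add: d_def dist_real_def)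
  ultimately have interior: "z1 \<in> {s<..<T} \<times> UNIV" "z2 \<in> {s<..<T} \<times> UNIV"
    using S d Kn(2) T1 by (auto simp: S_def mem_Times_iff)

  define U where "U = {s<..<T} \<times> (UNIV :: 'a set)"
  have U: "open U" "U \<subseteq> {s<..} \<times> UNIV" "U \<subseteq> S"
    unfolding U_def S_def by (intro open_Times Sigma_mono; auto)+
  \<comment> \<open>Freezing one variable of \<Phi> at the maximum gives the two test functions; the
    constants make them touch \<open>v\<close> and \<open>w\<close>.\<close>
  define \<phi> where "\<phi> = (\<lambda>z. (w z2 + \<Phi> (z1, z2)) + n * ((z - z2) \<bullet> (z - z2))
      + \<beta> * ((snd z - x0) \<bullet> (snd z - x0)) + a * exp (k * fst z))"
  have "contact_above U \<phi> v z1"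
    unfolding contact_above_def
  proof (intro conjI ballI)
    show "\<phi> z1 = v z1"
      by (simp add: \<phi>_def \<Phi>_def)
    fix z assume "z \<in> U"
    then show "v z \<le> \<phi> z"
      using max[of z z2] S U(3) by (auto simp: \<phi>_def \<Phi>_def)
  qed
  then have "HJ_op H \<phi> z1 \<le> 0"
    by (intro viscosity_solutionD(1)[OF v U(1) _ U(2)])
      (use interior in \<open>auto simp only: U_def \<phi>_def intro!: smooth_on_penalty\<close>)
  then have sub: "2 * n * (fst z1 - fst z2) + k * (a * exp (k * fst z1))
      + H ((2 * n) *\<^sub>R (snd z1 - snd z2) + (2 * \<beta>) *\<^sub>R (snd z1 - x0)) \<le> 0"
    unfolding HJ_op_def \<phi>_def grad_penalty by (simp add: mult.commute mult.left_commute)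
  define \<eta> where "\<eta> = (\<lambda>z. (w z2 + n * ((z1 - z2) \<bullet> (z1 - z2))) + (- n) * ((z - z1) \<bullet> (z - z1))
      + 0 * ((snd z - x0) \<bullet> (snd z - x0)) + 0 * exp (k * fst z))"
  have "contact_below U \<eta> w z2"
    unfolding contact_below_def
  proof (intro conjI ballI)
    have sym: "(z - z1) \<bullet> (z - z1) = (z1 - z) \<bullet> (z1 - z)" for z
      by (simp add: inner_diff_left inner_diff_right inner_commute)
    show "\<eta> z2 = w z2"
      by (simp add: \<eta>_def sym)
    fix z assume "z \<in> U"
    then show "\<eta> z \<le> w z"
      using max[of z1 z] S U(3) by (auto simp: \<eta>_def \<Phi>_def sym)
  qed
  then have "HJ_op H \<eta> z2 \<ge> 0"
    by (intro viscosity_solutionD(2)[OF w U(1) _ U(2)])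
      (use interior in \<open>auto simp only: U_def \<eta>_def intro!: smooth_on_penalty\<close>)
  then have super: "2 * n * (fst z1 - fst z2) + H ((2 * n) *\<^sub>R (snd z1 - snd z2)) \<ge> 0"
    unfolding HJ_op_def \<eta>_def grad_penalty by (simp add: algebra_simps)

  define q where "q = (2 * n) *\<^sub>R (snd z1 - snd z2)"
  define q' where "q' = q + (2 * \<beta>) *\<^sub>R (snd z1 - x0)"
  have "norm (snd z1 - snd z2) \<le> K / n"
    using dist_snd_le[of z1 z2] d by (simp add: d_def dist_norm)
  then have "n * norm (snd z1 - snd z2) \<le> K"
    using n(1) by (simp add: pos_le_divide_eq mult.commute)
  moreover have "norm q = 2 * (n * norm (snd z1 - snd z2))"
    using n(1) by (simp add: q_def)
  ultimately have q: "norm q \<le> 2 * K"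
    by simp
  have "\<beta> * (dist (snd z1) x0)\<^sup>2 \<le> C + 1"
    using coercive[OF S] \<Phi>_ge \<open>\<delta> > 0\<close> \<open>a * exp (k * fst z1) > 0\<close> zero_le_power2[of "dist z1 z2"] by linarith
  then have "4 * \<beta> * (\<beta> * (dist (snd z1) x0)\<^sup>2) \<le> 4 * \<beta> * (C + 1)"
    using \<beta>(1) by (intro mult_left_mono) auto
  moreover have "(dist q' q)\<^sup>2 = 4 * \<beta> * (\<beta> * (dist (snd z1) x0)\<^sup>2)"
    using \<beta>(1) by (simp add: q'_def dist_norm power2_eq_square)
  moreover have "4 * \<beta> * (C + 1) = (r / 2)\<^sup>2"
    using \<beta>(2) by (simp add: power_divide)
  ultimately have "(dist q' q)\<^sup>2 \<le> (r / 2)\<^sup>2"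
    by linarith
  then have "dist q' q \<le> r / 2"
    by (rule power2_le_imp_le) (use r(1) in simp)
  then have "dist q' q < r"
    using r(1) by simp
  moreover have "norm q' \<le> norm q + dist q' q"
    using norm_triangle_ineq2[of q' q] by (simp add: dist_norm)
  ultimately have "dist (H q') (H q) < \<kappa>"
    using q r by (intro e) auto
  \<comment> \<open>In the difference of the two viscosity inequalities the time slopes
    \<open>2 * n * (fst z1 - fst z2)\<close> cancel, leaving \<open>H q - H q'\<close> at least
    \<kappa>.\<close>
  then have "H q - H q' < \<kappa>"
    unfolding dist_real_def by linarith
  moreover have "\<kappa> \<le> k * (a * exp (k * fst z1))"
    unfolding \<kappa>_def using S(1) \<open>k > 0\<close> \<open>a > 0\<close> by (intro mult_left_mono) (auto simp: S_def)
  ultimately show False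
    using sub super unfolding q'_def q_def by linarith
qed

section \<open>From comparison to uniqueness\<close>

lemma viscosity_evolution_lipschitz:
  assumes u: "lipschitz_fun u" and v: "viscosity_evolution H s u v" and "s < T"
  obtains K where "K-lipschitz_on ({s..T} \<times> UNIV) v"
proof -
  obtain L where "L-lipschitz_on UNIV u"
    using u by (auto simp: lipschitz_fun_def)
  then have "L-lipschitz_on ({s<..<T} \<times> UNIV) (\<lambda>z. u (snd z))"
    by (rule lipschitz_on_snd)
  moreover obtain K where "K-lipschitz_on ({s<..<T} \<times> UNIV) (\<lambda>(t, x). v (t, x) - u x)"
    using v \<open>s < T\<close> unfolding viscosity_evolution_def by blast
  ultimately have "(K + L)-lipschitz_on ({s<..<T} \<times> UNIV) (\<lambda>z. (case z of (t, x) \<Rightarrow> v (t, x) - u x) + u (snd z))"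
    by (intro lipschitz_on_add)
  then have "(K + L)-lipschitz_on ({s<..<T} \<times> UNIV) v"
    by (simp add: split_beta)
  \<comment> \<open>The evolution class controls only the open slab; continuity up to time
    \<open>s\<close> carries the constant to the closure.\<close>
  moreover have closure: "closure ({s<..<T} \<times> UNIV) = {s..T} \<times> UNIV"
    using \<open>s < T\<close> by (simp add: closure_Times)
  moreover have "continuous_on ({s..T} \<times> UNIV) v"
    using v unfolding viscosity_evolution_def viscosity_solution_Cauchy_def
    by (auto elim!: continuous_on_subset)
  ultimately have "(K + L)-lipschitz_on ({s..T} \<times> UNIV) v"
    using lipschitz_on_closure by metis
  then show ?thesis
    by (rule that)
qed

lemma viscosity_evolution_le:
  assumes "continuous_on UNIV H" "lipschitz_fun u"
    and v: "viscosity_evolution H s u v" and w: "viscosity_evolution H s u w" and "s \<le> t"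
  shows "v (t, x) \<le> w (t, x)"
proof (cases "s = t")
  case True
  then show ?thesis
    using v w by (simp add: viscosity_evolution_def viscosity_solution_Cauchy_def)
next
  case False
  then have "s < t" "t < t + 1" "s < t + 1"
    using \<open>s \<le> t\<close> by auto
  obtain K where "K-lipschitz_on ({s..t + 1} \<times> UNIV) v"
    using viscosity_evolution_lipschitz[OF assms(2) v \<open>s < t + 1\<close>] .
  moreover obtain K' where "K'-lipschitz_on ({s..t + 1} \<times> UNIV) w"
    using viscosity_evolution_lipschitz[OF assms(2) w \<open>s < t + 1\<close>] .
  ultimately have "(max K K')-lipschitz_on ({s..t + 1} \<times> UNIV) v" "(max K K')-lipschitz_on ({s..t + 1} \<times> UNIV) w"
    by (auto intro: lipschitz_on_le)
  then show ?thesis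
    using viscosity_comparison[OF assms(1), of s v w _ "t + 1" t x] v w \<open>s < t\<close>
    by (simp add: viscosity_evolution_def viscosity_solution_Cauchy_def)
qed

text \<open>Lets a solution be replaced by its restriction to times from \<open>s\<close> on, the
  extensional representative in \<open>visc_op\<close>. Contacts see only the open
  half-space.\<close>

lemma viscosity_evolution_cong:
  assumes eq: "\<And>z. z \<in> {s..} \<times> UNIV \<Longrightarrow> v z = w z"
    and v: "viscosity_evolution H s u v"
  shows "viscosity_evolution H s u w"
proof -
  have eq': "v (t, x) = w (t, x)" if "s \<le> t" for t x
    using eq that by simp
  have "contact_above U \<phi> w z = contact_above U \<phi> v z" "contact_below U \<phi> w z = contact_below U \<phi> v z"
    if "z \<in> U" "U \<subseteq> {s<..} \<times> UNIV" for U \<phi> z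
  proof -
    have "v y = w y" if "y \<in> U" for y
      using eq[of y] that \<open>U \<subseteq> {s<..} \<times> UNIV\<close> by force
    then show "contact_above U \<phi> w z = contact_above U \<phi> v z" "contact_below U \<phi> w z = contact_below U \<phi> v z"
      using \<open>z \<in> U\<close> by (simp_all add: contact_above_def contact_below_def)
  qed
  moreover have "continuous_on ({s<..} \<times> UNIV) w = continuous_on ({s<..} \<times> UNIV) v"
    "continuous_on ({s..} \<times> UNIV) w = continuous_on ({s..} \<times> UNIV) v"
    by (intro continuous_on_cong refl; force simp: eq')+
  ultimately have "viscosity_solution_Cauchy H s u w"
    using v eq' unfolding viscosity_evolution_def viscosity_solution_Cauchy_def viscosity_solution_def
    by (smt (verit, best) order_refl)
  moreover have "(\<lambda>(t, x). v (t, x) - u x) ` ({s<..<T} \<times> UNIV) = (\<lambda>(t, x). w (t, x) - u x) ` ({s<..<T} \<times> UNIV)" for T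
    by (intro image_cong) (auto simp: eq')
  moreover have "L-lipschitz_on ({s<..<T} \<times> UNIV) (\<lambda>(t, x). w (t, x) - u x)
      = L-lipschitz_on ({s<..<T} \<times> UNIV) (\<lambda>(t, x). v (t, x) - u x)" for T L
    by (intro lipschitz_on_cong) (auto simp: eq')
  ultimately show ?thesis
    using v unfolding viscosity_evolution_def by simp
qed

lemma visc_op_eqI:
  assumes "continuous_on UNIV H" "lipschitz_fun u"
    and w: "viscosity_evolution H s u w" and "s \<le> t"
  shows "visc_op H s t u x = w (t, x)"
proof -
  have "(THE v. v \<in> extensional ({s..} \<times> UNIV) \<and> viscosity_evolution H s u v) = restrict w ({s..} \<times> UNIV)"
  proof (rule the_equality, intro conjI)
    show "viscosity_evolution H s u (restrict w ({s..} \<times> UNIV))"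
      by (rule viscosity_evolution_cong[OF _ w]) simp
    fix v assume v: "v \<in> extensional ({s..} \<times> UNIV) \<and> viscosity_evolution H s u v"
    then have "v (t, x) = w (t, x)" if "s \<le> t" for t x
      using viscosity_evolution_le[OF assms(1,2) _ w that] viscosity_evolution_le[OF assms(1,2) w _ that]
      by (simp add: order_antisym)
    with v show "v = restrict w ({s..} \<times> UNIV)"
      by (intro extensionalityI[of _ "{s..} \<times> UNIV"]) auto
  qed simp
  then show ?thesis
    using \<open>s \<le> t\<close> by (simp add: visc_op_def)
qed

section \<open>The concave conjugate and the minimum formula\<close>

lemma conj_dom_iff: "p \<in> conj_dom u \<longleftrightarrow> (\<exists>c. \<forall>x. c \<le> p \<bullet> x - u x)"
proof
  assume "p \<in> conj_dom u"
  then have "- \<infinity> < concave_conj u p"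
    by (simp add: conj_dom_def)
  then obtain c where "ereal c < concave_conj u p"
    using ereal_dense2 by blast
  then have "ereal c \<le> ereal (p \<bullet> x - u x)" for x
    unfolding concave_conj_def by (rule less_imp_le[OF less_INF_D]) simp
  then show "\<exists>c. \<forall>x. c \<le> p \<bullet> x - u x"
    by auto
next
  assume "\<exists>c. \<forall>x. c \<le> p \<bullet> x - u x"
  then obtain c where "\<And>x. c \<le> p \<bullet> x - u x" by blast
  then have "ereal c \<le> concave_conj u p"
    unfolding concave_conj_def by (intro INF_greatest) auto
  then show "p \<in> conj_dom u"
    unfolding conj_dom_def by auto
qed

text \<open>The conversion to a real is faithful: membership in the domain excludes the value minus
  infinity, and the point 0 excludes plus infinity.\<close>

lemma le_concave_conj_iff:
  assumes "p \<in> conj_dom u"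
  shows "c \<le> real_of_ereal (concave_conj u p) \<longleftrightarrow> (\<forall>x. c \<le> p \<bullet> x - u x)"
proof -
  have "concave_conj u p \<le> ereal (p \<bullet> 0 - u 0)"
    unfolding concave_conj_def by (rule INF_lower) simp
  then have "concave_conj u p \<noteq> \<infinity>"
    by auto
  then have "c \<le> real_of_ereal (concave_conj u p) \<longleftrightarrow> ereal c \<le> concave_conj u p"
    using assms by (cases "concave_conj u p") (auto simp: conj_dom_def)
  then show ?thesis
    by (simp add: concave_conj_def le_INF_iff)
qed

text \<open>The term is a supremum over \<open>y\<close> of expressions continuous in
  \<open>p\<close> when \<open>H\<close> is. This handles it without the conjugate, which need not
  be continuous.\<close>

lemma hopf_term_le_iff:
  assumes "p \<in> conj_dom u"
  shows "hopf_term H u t x p \<le> r \<longleftrightarrow> (\<forall>y. p \<bullet> (x - y) + u y - t * H p \<le> r)"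
proof -
  have "hopf_term H u t x p \<le> r \<longleftrightarrow> p \<bullet> x - t * H p - r \<le> real_of_ereal (concave_conj u p)"
    unfolding hopf_term_def by linarith
  also have "\<dots> \<longleftrightarrow> (\<forall>y. p \<bullet> (x - y) + u y - t * H p \<le> r)"
    unfolding le_concave_conj_iff[OF assms]
    by (intro all_cong1) (auto simp: inner_diff_right)
  finally show ?thesis .
qed

lemma superdiff_imp_conj_dom:
  assumes "p \<in> superdiff u x"
  shows "p \<in> conj_dom u" "hopf_term H u t y p \<le> u x + p \<bullet> (y - x) - t * H p"
proof -
  have *: "u z \<le> u x + p \<bullet> (z - x)" for z
    using assms by (simp add: superdiff_def)
  have "p \<bullet> x - u x \<le> p \<bullet> z - u z" for z
    using *[of z] by (simp add: inner_diff_right)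
  then show "p \<in> conj_dom u"
    unfolding conj_dom_iff by blast
  show "hopf_term H u t y p \<le> u x + p \<bullet> (y - x) - t * H p"
    unfolding hopf_term_le_iff[OF \<open>p \<in> conj_dom u\<close>]
  proof (intro allI)
    fix z
    show "p \<bullet> (y - z) + u z - t * H p \<le> u x + p \<bullet> (y - x) - t * H p"
      using *[of z] by (simp add: inner_diff_right)
  qed
qed

text \<open>Along the ray \<open>- r *\<^sub>R p\<close> the affine part falls at rate
  \<open>norm p\<close> squared, while \<open>u\<close> falls at rate at most
  \<open>L * norm p\<close>; a lower bound for all \<open>r\<close> forces
  \<open>norm p \<le> L\<close>.\<close>

lemma conj_dom_norm_le:
  assumes "L-lipschitz_on UNIV u" "p \<in> conj_dom u"
  shows "norm p \<le> L"
proof (rule ccontr)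
  assume "\<not> norm p \<le> L"
  moreover have "0 \<le> L"
    using assms(1) lipschitz_on_nonneg by blast
  ultimately have pos: "norm p * (norm p - L) > 0"
    by (intro mult_pos_pos) auto
  obtain c where c: "c \<le> p \<bullet> x - u x" for x
    using assms(2) conj_dom_iff by blast
  have "r * (norm p * (norm p - L)) \<le> - c - u 0" if "r \<ge> 0" for r
  proof -
    have "c \<le> p \<bullet> (- r *\<^sub>R p) - u (- r *\<^sub>R p)"
      by (rule c)
    moreover have "\<bar>u (- r *\<^sub>R p) - u 0\<bar> \<le> L * (r * norm p)"
      using lipschitz_onD[OF assms(1), of "- r *\<^sub>R p" 0] that by (simp add: dist_norm)
    ultimately show ?thesis
      by (simp add: power2_norm_eq_inner[symmetric] power2_eq_square algebra_simps)
  qed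
  moreover obtain n where "- c - u 0 < real n * (norm p * (norm p - L))"
    using pos reals_Archimedean3 by blast
  ultimately show False
    by (metis not_le of_nat_0_le_iff)
qed

section \<open>The minimum formula for Lipschitz concave data\<close>

locale concave_cauchy =
  fixes H u :: "'a::euclidean_space \<Rightarrow> real" and L :: real
  assumes contH: "continuous_on UNIV H"
    and lip: "L-lipschitz_on UNIV u"
    and conc: "concave_on UNIV u"
begin

lemma L_nonneg: "0 \<le> L"
  using lip lipschitz_on_nonneg by blast

lemma conj_dom_nonempty: "conj_dom u \<noteq> {}"
  using superdiff_nonempty[OF conc, of 0] superdiff_imp_conj_dom(1) by blast

text \<open>The sublevel epigraph of the objective is compact because each \<open>u y\<close> enters through a
  closed condition; \<open>conj_dom u\<close> itself need not be closed.\<close>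

lemma hopf_term_attains_min:
  "\<exists>p\<in>conj_dom u. \<forall>p'\<in>conj_dom u. hopf_term H u t x p \<le> hopf_term H u t x p'"
proof -
  obtain p1 where p1: "p1 \<in> conj_dom u"
    using conj_dom_nonempty by blast
  let ?f = "hopf_term H u t x"
  define Q where "Q = cball (0::'a) L"
  have contH': "continuous_on S (\<lambda>p. H (f p))" if "continuous_on S f"
    for f :: "'b::topological_space \<Rightarrow> 'a" and S
    using continuous_on_compose2[OF contH that] by auto
  have "continuous_on Q (\<lambda>p. p \<bullet> x + u 0 - t * H p)"
    by (intro continuous_intros contH')
  then have "bounded ((\<lambda>p. p \<bullet> x + u 0 - t * H p) ` Q)"
    by (intro compact_imp_bounded compact_continuous_image) (auto simp: Q_def)
  then obtain M where M: "\<And>p. p \<in> Q \<Longrightarrow> \<bar>p \<bullet> x + u 0 - t * H p\<bar> \<le> M"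
    unfolding bounded_iff by auto
  \<comment> \<open>Minimise the height \<open>r\<close> over pairs \<open>(p, r)\<close>. The floor
    \<open>- M\<close> comes from the condition at \<open>y = 0\<close>, the ceiling from the
    competitor \<open>p1\<close>.\<close>
  define K where "K = (Q \<times> {- M..?f p1}) \<inter>
    (\<Inter>y. {z. fst z \<bullet> (x - y) + u y - t * H (fst z) \<le> snd z})"
  have "closed {z. fst z \<bullet> (x - y) + u y - t * H (fst z) \<le> snd z}" for y
    by (intro closed_Collect_le continuous_intros contH')
  then have "compact K"
    unfolding K_def Q_def by (intro compact_Int_closed compact_Times closed_INT) auto
  have mem: "(p, ?f p) \<in> K" if "p \<in> conj_dom u" "?f p \<le> ?f p1" for p
  proof -
    have *: "p \<bullet> (x - y) + u y - t * H p \<le> ?f p" for y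
      using hopf_term_le_iff[OF that(1)] by blast
    have "p \<in> Q"
      using conj_dom_norm_le[OF lip that(1)] by (simp add: Q_def)
    then show ?thesis
      using *[of 0] M[of p] that * by (auto simp: K_def)
  qed
  moreover have "continuous_on K snd"
    by (intro continuous_intros)
  ultimately obtain z where z: "z \<in> K" "\<And>z'. z' \<in> K \<Longrightarrow> snd z \<le> snd z'"
    using continuous_attains_inf[of K snd] \<open>compact K\<close> p1 by blast
  obtain p r where "z = (p, r)"
    by fastforce
  with z have le: "p \<bullet> (x - y) + u y - t * H p \<le> r" "r \<le> ?f p1" for y
    by (auto simp: K_def)
  \<comment> \<open>The finite height bounds the conjugate from below, so the limit point lies in
    the domain after all.\<close>
  have "p \<bullet> x - t * H p - r \<le> p \<bullet> y - u y" for y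
    using le(1)[of y] by (simp add: inner_diff_right)
  then have p: "p \<in> conj_dom u"
    unfolding conj_dom_iff by blast
  then have "?f p \<le> r"
    using le by (simp add: hopf_term_le_iff)
  moreover have "r \<le> ?f p'" if "p' \<in> conj_dom u" for p'
    using z(2)[OF mem[OF that]] le \<open>z = (p, r)\<close> by fastforce
  ultimately show ?thesis
    using p by (meson order_trans)
qed

lemma hopf_attained:
  obtains p where "p \<in> conj_dom u" "hopf H u t x = hopf_term H u t x p"
proof -
  obtain p where p: "p \<in> conj_dom u" "\<And>p'. p' \<in> conj_dom u \<Longrightarrow> hopf_term H u t x p \<le> hopf_term H u t x p'"
    using hopf_term_attains_min by blast
  then have "hopf H u t x = hopf_term H u t x p"
    unfolding hopf_def by (intro cInf_eq_minimum) auto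
  with p show ?thesis
    using that by blast
qed

lemma hopf_le:
  assumes "p \<in> conj_dom u"
  shows "hopf H u t x \<le> hopf_term H u t x p"
proof -
  obtain q where "\<And>p'. p' \<in> conj_dom u \<Longrightarrow> hopf_term H u t x q \<le> hopf_term H u t x p'"
    using hopf_term_attains_min by blast
  then show ?thesis
    unfolding hopf_def using assms by (intro cINF_lower bdd_belowI2)
qed

text \<open>Biduality for concave \<open>u\<close>: a supergradient at \<open>x\<close> attains the
  value, and the Fenchel inequality gives the other direction.\<close>

lemma hopf_zero: "hopf H u 0 x = u x"
proof (rule antisym)
  obtain p where "p \<in> superdiff u x"
    using superdiff_nonempty[OF conc] by blast
  then show "hopf H u 0 x \<le> u x"
    using hopf_le[of p 0 x] superdiff_imp_conj_dom(1)[of p u x] superdiff_imp_conj_dom(2)[of p u x H 0 x]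
    by simp
next
  obtain p where p: "p \<in> conj_dom u" "hopf H u 0 x = hopf_term H u 0 x p"
    by (rule hopf_attained)
  have "p \<bullet> (x - x) + u x - 0 * H p \<le> hopf_term H u 0 x p"
    using hopf_term_le_iff[OF p(1), of H 0 x "hopf_term H u 0 x p"] by blast
  then show "u x \<le> hopf H u 0 x"
    using p(2) by simp
qed

lemma hopf_term_affine:
  "hopf_term H u t x p = hopf_term H u s y p + p \<bullet> (x - y) - (t - s) * H p"
  by (simp add: hopf_term_def inner_diff_right algebra_simps)

lemma H_bounded:
  obtains M where "0 \<le> M" "\<And>p. p \<in> conj_dom u \<Longrightarrow> \<bar>H p\<bar> \<le> M"
proof -
  have "bounded (H ` cball 0 L)"
    by (intro compact_imp_bounded compact_continuous_image continuous_on_subset[OF contH]) auto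
  then obtain M where "\<And>p. p \<in> cball 0 L \<Longrightarrow> \<bar>H p\<bar> \<le> M"
    unfolding bounded_iff by (metis imageI real_norm_def)
  then have "\<bar>H p\<bar> \<le> max M 0" if "p \<in> conj_dom u" for p
    using conj_dom_norm_le[OF lip that] by (simp add: le_max_iff_disj)
  then show ?thesis
    using that[of "max M 0"] by auto
qed

text \<open>The minimiser at \<open>(s, y)\<close> competes at \<open>(t, x)\<close>, and its affine
  term has space slope at most \<open>L\<close> and time slope at most \<open>M\<close>.\<close>

lemma hopf_diff_le:
  assumes M: "\<And>p. p \<in> conj_dom u \<Longrightarrow> \<bar>H p\<bar> \<le> M"
  shows "hopf H u t x \<le> hopf H u s y + L * norm (x - y) + M * \<bar>t - s\<bar>"
proof -
  obtain p where p: "p \<in> conj_dom u" "hopf H u s y = hopf_term H u s y p"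
    by (rule hopf_attained)
  have "hopf H u t x \<le> hopf_term H u s y p + p \<bullet> (x - y) - (t - s) * H p"
    using hopf_le[OF p(1)] hopf_term_affine by metis
  also have "p \<bullet> (x - y) \<le> L * norm (x - y)"
    by (rule order_trans[OF norm_cauchy_schwarz mult_right_mono[OF conj_dom_norm_le[OF lip p(1)]]]) simp
  also have "- ((t - s) * H p) \<le> M * \<bar>t - s\<bar>"
  proof -
    have "- ((t - s) * H p) \<le> \<bar>t - s\<bar> * \<bar>H p\<bar>"
      using abs_ge_minus_self[of "(t - s) * H p"] by (simp only: abs_mult)
    also have "\<dots> \<le> \<bar>t - s\<bar> * M"
      using M[OF p(1)] by (intro mult_left_mono) auto
    finally show ?thesis by (simp add: mult.commute)
  qed
  ultimately show ?thesis
    using p(2) by linarith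
qed

lemma hopf_lipschitz: "\<exists>K. K-lipschitz_on UNIV (\<lambda>(t, x). hopf H u t x)"
proof -
  obtain M where M: "0 \<le> M" "\<And>p. p \<in> conj_dom u \<Longrightarrow> \<bar>H p\<bar> \<le> M"
    using H_bounded by blast
  have *: "hopf H u t x - hopf H u s y \<le> (L + M) * dist (t, x) (s, y)" for t x s y
  proof -
    have "norm (x - y) \<le> dist (t, x) (s, y)" "\<bar>t - s\<bar> \<le> dist (t, x) (s, y)"
      using dist_snd_le[of "(t, x)" "(s, y)"] dist_fst_le[of "(t, x)" "(s, y)"]
      by (auto simp: dist_norm)
    then have "L * norm (x - y) + M * \<bar>t - s\<bar> \<le> L * dist (t, x) (s, y) + M * dist (t, x) (s, y)"
      using L_nonneg M(1) by (intro add_mono mult_left_mono)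
    then show ?thesis
      using hopf_diff_le[OF M(2), of t x s y] by (simp add: distrib_right)
  qed
  have "(L + M)-lipschitz_on UNIV (\<lambda>(t, x). hopf H u t x)"
  proof (rule lipschitz_onI)
    show "0 \<le> L + M"
      using L_nonneg M(1) by simp
    fix z z' :: "real \<times> 'a"
    show "dist (case z of (t, x) \<Rightarrow> hopf H u t x) (case z' of (t, x) \<Rightarrow> hopf H u t x) \<le> (L + M) * dist z z'"
      using *[of "fst z" "snd z" "fst z'" "snd z'"] *[of "fst z'" "snd z'" "fst z" "snd z"]
      by (cases z; cases z') (simp add: dist_real_def abs_le_iff dist_commute)
  qed
  then show ?thesis by blast
qed

lemma hopf_concave: "concave_on UNIV (\<lambda>(t, x). hopf H u t x)"
  unfolding concave_on_def
proof (rule convex_onI)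
  fix s :: real and z z' :: "real \<times> 'a"
  assume s: "0 < s" "s < 1"
  let ?z = "(1 - s) *\<^sub>R z + s *\<^sub>R z'"
  obtain p where p: "p \<in> conj_dom u" "hopf H u (fst ?z) (snd ?z) = hopf_term H u (fst ?z) (snd ?z) p"
    by (rule hopf_attained)
  have "hopf_term H u (fst ?z) (snd ?z) p =
      (1 - s) * hopf_term H u (fst z) (snd z) p + s * hopf_term H u (fst z') (snd z') p"
    by (simp add: hopf_term_def inner_add_right algebra_simps)
  also have "\<dots> \<ge> (1 - s) * hopf H u (fst z) (snd z) + s * hopf H u (fst z') (snd z')"
    using s hopf_le[OF p(1)] by (intro add_mono mult_left_mono) auto
  finally show "- (case ?z of (t, x) \<Rightarrow> hopf H u t x) \<le>
      (1 - s) * - (case z of (t, x) \<Rightarrow> hopf H u t x) + s * - (case z' of (t, x) \<Rightarrow> hopf H u t x)"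
    using p(2) by (simp add: split_beta)
qed simp

section \<open>The viscosity inequalities\<close>

lemma superdiff_hopf_subsolution:
  assumes "z \<in> superdiff (\<lambda>(t, x). hopf H u t x) (t, x)" "t > 0"
  shows "fst z + H (snd z) \<le> 0"
proof -
  define a p where "a = fst z" and "p = snd z"
  have global: "(\<lambda>(t, x). hopf H u t x) z' \<le> hopf H u t x + z \<bullet> (z' - (t, x))" for z'
    using assms(1) unfolding superdiff_def by (cases z') simp
  have *: "u y \<le> hopf H u t x - a * t + p \<bullet> (y - x)" for y
    using global[of "(0, y)"] by (simp add: a_def p_def inner_prod_def hopf_zero)
  have "p \<bullet> x - hopf H u t x + a * t \<le> p \<bullet> y - u y" for y
    using *[of y] by (simp add: inner_diff_right)
  then have p: "p \<in> conj_dom u"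
    unfolding conj_dom_iff by blast
  have "p \<bullet> (x - y) + u y - t * H p \<le> hopf H u t x - a * t - t * H p" for y
    using *[of y] by (simp add: inner_diff_right)
  \<comment> \<open>Since the left side is at least \<open>hopf H u t x\<close>, that value cancels
    and \<open>t * (a + H p) \<le> 0\<close> remains.\<close>
  then have "hopf_term H u t x p \<le> hopf H u t x - a * t - t * H p"
    using p by (simp add: hopf_term_le_iff)
  then have "t * (a + H p) \<le> 0"
    using hopf_le[OF p, of t x] by (simp add: algebra_simps)
  then show ?thesis
    using assms(2) by (simp add: mult_le_0_iff a_def p_def)
qed

lemma hopf_term_has_derivative:
  "((\<lambda>z. hopf_term H u (fst z) (snd z) p) has_derivative (\<lambda>h. h \<bullet> (- H p, p))) (at z)"
proof -
  have "(\<lambda>z. hopf_term H u (fst z) (snd z) p) = (\<lambda>z. (- H p, p) \<bullet> z - real_of_ereal (concave_conj u p))"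
    by (simp add: fun_eq_iff hopf_term_def inner_prod_def)
  moreover have "\<dots> = (\<lambda>z. z \<bullet> (- H p, p) - real_of_ereal (concave_conj u p))"
    by (simp only: inner_commute)
  moreover have "(\<dots> has_derivative (\<lambda>h. h \<bullet> (- H p, p) - 0)) (at z)"
    by (intro has_derivative_diff has_derivative_inner_left has_derivative_ident has_derivative_const)
  ultimately show ?thesis
    by simp
qed

lemma hopf_viscosity_Cauchy: "viscosity_solution_Cauchy H 0 u (\<lambda>(t, x). hopf H u t x)"
  unfolding viscosity_solution_Cauchy_def viscosity_solution_def
proof (intro conjI ballI allI impI; (elim conjE)?)
  show "continuous_on S (\<lambda>(t, x). hopf H u t x)" for S
    using hopf_lipschitz lipschitz_on_continuous_on continuous_on_subset by blast
  then show "continuous_on S (\<lambda>(t, x). hopf H u t x)" for S .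
  show "(case (0, x) of (t, x) \<Rightarrow> hopf H u t x) = u x" for x
    by (simp add: hopf_zero)
next
  fix z :: "real \<times> 'a" and U \<phi>
  assume z: "z \<in> {0<..} \<times> UNIV" and U: "open U" "z \<in> U" and "smooth_on U \<phi>"
  then have diff: "\<phi> differentiable (at z)"
    unfolding smooth_on_def using Ck_on.simps(2) by blast
  obtain t x where tx: "z = (t, x)" "t > 0"
    using z by auto
  {
    assume "contact_above U \<phi> (\<lambda>(t, x). hopf H u t x) z"
    then have "grad \<phi> z \<in> superdiff (\<lambda>(t, x). hopf H u t x) (t, x)"
      using grad_in_superdiff[OF hopf_concave diff U] tx by simp
    then show "HJ_op H \<phi> z \<le> 0"
      unfolding HJ_op_def using superdiff_hopf_subsolution tx(2) by blast
  next
    assume below: "contact_below U \<phi> (\<lambda>(t, x). hopf H u t x) z"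
    obtain p where p: "p \<in> conj_dom u" "hopf H u t x = hopf_term H u t x p"
      by (rule hopf_attained)
    have "\<phi> y \<le> hopf_term H u (fst y) (snd y) p" if "y \<in> U" for y
      using below that hopf_le[OF p(1), of "fst y" "snd y"]
      unfolding contact_below_def split_beta by (meson order_trans)
    moreover have "\<phi> z = hopf_term H u (fst z) (snd z) p"
      using below p(2) tx by (simp add: contact_below_def)
    \<comment> \<open>The minimising affine term lies above the formula and meets it at
      \<open>z\<close>, so the difference has a local maximum and the gradients agree.\<close>
    ultimately have "\<forall>\<^sub>F y in at z. \<phi> y - hopf_term H u (fst y) (snd y) p \<le> \<phi> z - hopf_term H u (fst z) (snd z) p"
      using U unfolding eventually_at_topological by (intro exI[of _ U]) auto
    then have "(\<lambda>h. h \<bullet> grad \<phi> z - h \<bullet> (- H p, p)) = (\<lambda>h. 0)"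
      by (intro has_derivative_local_max[of "\<lambda>y. \<phi> y - hopf_term H u (fst y) (snd y) p" _ z]
          has_derivative_diff has_derivative_grad diff hopf_term_has_derivative)
    from fun_cong[OF this, of "grad \<phi> z - (- H p, p)"]
    have "(grad \<phi> z - (- H p, p)) \<bullet> (grad \<phi> z - (- H p, p)) = 0"
      by (simp only: inner_diff_right)
    then have "grad \<phi> z = (- H p, p)"
      by simp
    then show "HJ_op H \<phi> z \<ge> 0"
      by (simp add: HJ_op_def)
  }
qed

lemma hopf_viscosity_evolution: "viscosity_evolution H 0 u (\<lambda>(t, x). hopf H u t x)"
  unfolding viscosity_evolution_def
proof (intro conjI allI impI hopf_viscosity_Cauchy)
  fix T :: real
  obtain M where M: "0 \<le> M" "\<And>p. p \<in> conj_dom u \<Longrightarrow> \<bar>H p\<bar> \<le> M"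
    using H_bounded by blast
  have "\<bar>hopf H u t x - u x\<bar> \<le> M * T" if "0 < t" "t < T" for t x
  proof -
    have "M * t \<le> M * T"
      using that M(1) by (simp add: mult_left_mono)
    then show ?thesis
      using hopf_diff_le[OF M(2), of t x 0 x] hopf_diff_le[OF M(2), of 0 x t x] that
      by (simp add: hopf_zero abs_le_iff)
  qed
  then show "bounded ((\<lambda>(t, x). (case (t, x) of (t, x) \<Rightarrow> hopf H u t x) - u x) ` ({0<..<T} \<times> UNIV))"
    unfolding bounded_iff by (auto intro!: exI[of _ "M * T"])
  obtain K where "K-lipschitz_on UNIV (\<lambda>(t, x). hopf H u t x)"
    using hopf_lipschitz by blast
  then have "K-lipschitz_on ({0<..<T} \<times> UNIV) (\<lambda>(t, x). hopf H u t x)"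
    by (rule lipschitz_on_subset) simp
  moreover have "L-lipschitz_on ({0<..<T} \<times> (UNIV :: 'a set)) (\<lambda>z. u (snd z))"
    by (rule lipschitz_on_snd[OF lip])
  ultimately have "(K + L)-lipschitz_on ({0<..<T} \<times> UNIV) (\<lambda>z. (case z of (t, x) \<Rightarrow> hopf H u t x) - u (snd z))"
    by (rule lipschitz_on_diff)
  then show "\<exists>K. K-lipschitz_on ({0<..<T} \<times> UNIV) (\<lambda>(t, x). (case (t, x) of (t, x) \<Rightarrow> hopf H u t x) - u x)"
    by (intro exI[of _ "K + L"]) (simp add: split_beta)
qed

end

section \<open>The variational solution\<close>

lemma hamiltonian_trajectory_affine:
  assumes traj: "hamiltonian_trajectory H s t q p" and "s \<le> t"
  shows "q t = q s + (t - s) *\<^sub>R grad H (p s)"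
    and "integral {s..t} (\<lambda>\<tau>. p \<tau> \<bullet> vector_derivative q (at \<tau> within {s..t}) - H (p \<tau>))
      = (t - s) * (p s \<bullet> grad H (p s) - H (p s))"
proof -
  let ?c = "grad H (p s)"
  have dq: "(q has_vector_derivative grad H (p \<tau>)) (at \<tau> within {s..t})"
    and dp: "(p has_vector_derivative 0) (at \<tau> within {s..t})" if "\<tau> \<in> {s..t}" for \<tau>
    using traj that by (simp_all add: hamiltonian_trajectory_def)
  have "(p has_derivative (\<lambda>h. 0)) (at \<tau> within {s..t})" if "\<tau> \<in> {s..t}" for \<tau>
    using dp[OF that] by (simp add: has_vector_derivative_def)
  then have "\<exists>c. \<forall>\<tau>\<in>{s..t}. p \<tau> = c"
    by (intro has_derivative_zero_constant) auto
  then have p: "p \<tau> = p s" if "\<tau> \<in> {s..t}" for \<tau>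
    using that \<open>s \<le> t\<close> by (metis atLeastAtMost_iff order_refl)
  then have q: "(q has_vector_derivative ?c) (at \<tau> within {s..t})" if "\<tau> \<in> {s..t}" for \<tau>
    using dq[OF that] p[OF that] by simp
  have "((\<lambda>\<tau>. q \<tau> - \<tau> *\<^sub>R ?c) has_derivative (\<lambda>h. h *\<^sub>R ?c - h *\<^sub>R ?c)) (at \<tau> within {s..t})"
    if "\<tau> \<in> {s..t}" for \<tau>
    using q[OF that] unfolding has_vector_derivative_def
    by (rule has_derivative_diff[OF _ has_derivative_scaleR_left[OF has_derivative_ident]])
  then have "((\<lambda>\<tau>. q \<tau> - \<tau> *\<^sub>R ?c) has_derivative (\<lambda>h. 0)) (at \<tau> within {s..t})" if "\<tau> \<in> {s..t}" for \<tau>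
    using that by simp
  then have "\<exists>c. \<forall>\<tau>\<in>{s..t}. q \<tau> - \<tau> *\<^sub>R ?c = c"
    by (intro has_derivative_zero_constant) auto
  then have "q t - t *\<^sub>R ?c = q s - s *\<^sub>R ?c"
    using \<open>s \<le> t\<close> by (metis atLeastAtMost_iff order_refl)
  then show "q t = q s + (t - s) *\<^sub>R ?c"
    by (simp add: scaleR_diff_left diff_eq_eq)
  have "integral {s..t} (\<lambda>\<tau>. p \<tau> \<bullet> vector_derivative q (at \<tau> within {s..t}) - H (p \<tau>))
      = integral {s..t} (\<lambda>\<tau>. p s \<bullet> ?c - H (p s))"
  \<comment> \<open>On a one-point interval the derivative within it is not determined, but the
    integral vanishes.\<close>
  proof (cases "s = t")
    case False
    show ?thesis
    proof (rule integral_cong)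
      fix \<tau> assume "\<tau> \<in> {s..t}"
      then show "p \<tau> \<bullet> vector_derivative q (at \<tau> within {s..t}) - H (p \<tau>) = p s \<bullet> ?c - H (p s)"
        using p[of \<tau>] vector_derivative_within_closed_interval[OF _ _ q[of \<tau>]] False \<open>s \<le> t\<close> by simp
    qed
  qed simp
  then show "integral {s..t} (\<lambda>\<tau>. p \<tau> \<bullet> vector_derivative q (at \<tau> within {s..t}) - H (p \<tau>))
      = (t - s) * (p s \<bullet> ?c - H (p s))"
    using \<open>s \<le> t\<close> by simp
qed

lemma variational_resolution_mono:
  assumes "variational_resolution H A G" "s \<le> t" "lipschitz_fun u" "lipschitz_fun w" "\<And>x. u x \<le> w x"
  shows "G s t u x \<le> G s t w x"
  using assms(1)[unfolded variational_resolution_def, THEN conjunct2, THEN conjunct2, THEN conjunct2,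
      THEN conjunct1, rule_format, of s t u w x] assms(2-5) by blast

lemma variational_resolution_classical:
  assumes "variational_resolution H A G" "Ck_on 2 ({a<..<b} \<times> UNIV) f"
    "\<And>z. z \<in> {a<..<b} \<times> UNIV \<Longrightarrow> HJ_op H f z = 0"
    "a < s" "s \<le> t" "t < b" "lipschitz_fun (\<lambda>x. f (s, x))"
  shows "G s t (\<lambda>x. f (s, x)) = (\<lambda>x. f (t, x))"
  using assms(1)[unfolded variational_resolution_def, THEN conjunct2, THEN conjunct2, THEN conjunct2,
      THEN conjunct2, rule_format, of a b f s t] assms(2-7) by blast

context concave_cauchy
begin

lemma hopf_le_variational_solution:
  assumes g: "variational_solution H 0 u g" and "t > 0"
  shows "hopf H u t x \<le> g (t, x)"
proof -
  obtain q p where traj: "hamiltonian_trajectory H 0 t q p" and q: "q t = x"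
    and p: "p 0 \<in> clarke_diff u (q 0)"
    and g: "g (t, x) = u (q 0) +
      integral {0..t} (\<lambda>\<tau>. p \<tau> \<bullet> vector_derivative q (at \<tau> within {0..t}) - H (p \<tau>))"
    using assms unfolding variational_solution_def by blast
  have p0: "p 0 \<in> superdiff u (q 0)"
    using p clarke_diff_subset_superdiff[OF conc lipschitz_on_continuous_on[OF lip]] by blast
  have "hopf H u t x \<le> hopf_term H u t x (p 0)"
    using superdiff_imp_conj_dom(1)[OF p0] by (rule hopf_le)
  also have "\<dots> \<le> u (q 0) + p 0 \<bullet> (x - q 0) - t * H (p 0)"
    using superdiff_imp_conj_dom(2)[OF p0] .
  also have "\<dots> = g (t, x)"
    unfolding g hamiltonian_trajectory_affine(2)[OF traj less_imp_le[OF \<open>t > 0\<close>]]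
    using hamiltonian_trajectory_affine(1)[OF traj less_imp_le[OF \<open>t > 0\<close>]] q
    by (simp add: algebra_simps)
  finally show ?thesis .
qed

text \<open>The minimising affine term is a classical solution, so the resolution propagates it
  exactly; at time 0 it lies above \<open>u\<close>, and monotonicity keeps the order.\<close>

lemma variational_resolution_le_hopf:
  assumes G: "variational_resolution H A G" and "t \<ge> 0"
  shows "G 0 t u x \<le> hopf H u t x"
proof -
  obtain p where p: "p \<in> conj_dom u" "hopf H u t x = hopf_term H u t x p"
    by (rule hopf_attained)
  define f where "f = (\<lambda>z. hopf_term H u (fst z) (snd z) p)"
  have f_eq: "f = (\<lambda>z. - real_of_ereal (concave_conj u p) + (- H p, p) \<bullet> z + 0 * (z \<bullet> z)
      + 0 * (snd z \<bullet> snd z) + 0 * exp (0 * fst z))"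
    by (auto simp: f_def hopf_term_def fun_eq_iff inner_prod_def)
  \<comment> \<open>The clause on classical solutions asks for an open time interval; this one
    contains both 0 and \<open>t\<close>.\<close>
  have "smooth_on ({-1<..<t + 1} \<times> UNIV) f"
    unfolding f_eq by (rule smooth_on_quadratic_exp)
  then have "Ck_on 2 ({-1<..<t + 1} \<times> UNIV) f"
    unfolding smooth_on_def by blast
  moreover have "HJ_op H f z = 0" for z
    unfolding HJ_op_def f_def grad_eqI[OF hopf_term_has_derivative] by simp
  moreover have f_lip: "lipschitz_fun (\<lambda>x. f (0, x))"
    unfolding lipschitz_fun_def
  proof (intro exI lipschitz_onI)
    fix y z
    show "dist (f (0, y)) (f (0, z)) \<le> norm p * dist y z"
      using Cauchy_Schwarz_ineq2[of p "y - z"]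
      by (simp add: f_def hopf_term_def dist_norm inner_diff_right)
  qed simp
  ultimately have "G 0 t (\<lambda>x. f (0, x)) = (\<lambda>x. f (t, x))"
    using variational_resolution_classical[OF G, of "-1" "t + 1" f 0 t] \<open>t \<ge> 0\<close> by simp
  moreover have "u y \<le> f (0, y)" for y
    using hopf_le[OF p(1), of 0 y] by (simp add: hopf_zero f_def)
  moreover have "lipschitz_fun u"
    using lip by (auto simp: lipschitz_fun_def)
  ultimately have "G 0 t u x \<le> f (t, x)"
    using variational_resolution_mono[OF G \<open>t \<ge> 0\<close> _ f_lip, of u x] by simp
  then show ?thesis
    by (simp add: f_def p(2))
qed

lemma variational_resolution_eq_hopf:
  assumes G: "variational_resolution H A G" and "t \<ge> 0"
  shows "G 0 t u x = hopf H u t x"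
proof -
  have "lipschitz_fun u"
    using lip by (auto simp: lipschitz_fun_def)
  then have g: "variational_solution H 0 u (\<lambda>(t, x). G 0 t u x)"
    using G by (simp add: variational_resolution_def)
  show ?thesis
  \<comment> \<open>Trajectories are only provided for \<open>t > 0\<close>; at time 0 both sides
    are the initial data.\<close>
  proof (cases "t = 0")
    case True
    then show ?thesis
      using g by (simp add: variational_solution_def hopf_zero)
  next
    case False
    then show ?thesis
      using hopf_le_variational_solution[OF g, of t x] variational_resolution_le_hopf[OF assms] \<open>t \<ge> 0\<close>
      by (simp add: order_antisym)
  qed
qed

end

theorem corollary2:
  fixes H u0 :: "real ^ 'n \<Rightarrow> real"
  assumes "continuous_on UNIV H"
    and "lipschitz_fun u0"
    and "concave_on UNIV u0"
  shows "(\<forall>t\<ge>0. \<forall>x. \<exists>p. is_arg_min (hopf_term H u0 t x) (\<lambda>p. p \<in> conj_dom u0) p) \<and>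
    viscosity_solution_Cauchy H 0 u0 (\<lambda>(t, x). hopf H u0 t x) \<and>
    (\<forall>A. Ck_on 2 UNIV H \<and> hamiltonian_bounds H A \<longrightarrow>
       (\<forall>t\<ge>0. \<forall>x. visc_op H 0 t u0 x = hopf H u0 t x) \<and>
       (\<forall>G. variational_resolution H A G \<longrightarrow> (\<forall>t\<ge>0. \<forall>x. G 0 t u0 x = hopf H u0 t x)))"
proof -
  obtain L where "L-lipschitz_on UNIV u0"
    using assms(2) by (auto simp: lipschitz_fun_def)
  then interpret concave_cauchy H u0 L
    using assms by unfold_locales
  have "\<exists>p. is_arg_min (hopf_term H u0 t x) (\<lambda>p. p \<in> conj_dom u0) p" for t x
    using hopf_term_attains_min[of t x] by (auto simp: is_arg_min_linorder)
  then show ?thesis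
    using hopf_viscosity_Cauchy variational_resolution_eq_hopf
      visc_op_eqI[OF assms(1,2) hopf_viscosity_evolution]
    by auto
qed

end
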